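(* Let $I$ be a set and $\mathcal{E}=(E_i)_{i\in I}$ a family of nonempty sets. Then there exists a choice of the sets $E_i$ (i.e. a family $\mathcal{E}=(E_i)_{i\in I}$ of nonempty sets) such that for every integral connective structure $\mathcal{K}$ on $I$ there exists a multiple relation $R$ in $\mathcal{E}$ whose connective structure satisfies $\mathcal{K}_R=\mathcal{K}$.
   Context: For $J\subseteq I$ let $Z_J=\prod_{j\in J}E_j$ (its elements, the $J$-families, are maps $x:J\to\bigcup_i E_i$ with $x_j\in E_j$; $Z_\emptyset=\{\bullet\}$). A multiple relation in $\mathcal{E}$ is a pair $R=(J_R,G_R)$ with $J_R\subseteq I$ (the domain) and $G_R\subseteq Z_{J_R}$ (the graph); write $x\in R$ for $x\in G_R$. For $K\subseteq J_R$ the restriction is $R_{|K}=(K,\{x_{|K}:x\in G_R\})$, where $x_{|K}$ is the restriction of the map $x$ to $K$. The product of relations is $R\bowtie S=(J_R\cup J_S,\{x\in Z_{J_R\cup J_S}: x_{|J_R}\in G_R,\ x_{|J_S}\in G_S\})$. A bipartition of a set $J$ is a pair $(K,L)$ of nonempty disjoint subsets with $K\cup L=J$. A relation $T$ is scindable (splittable) if there is a bipartition $(K,L)$ of $J_T$ and relations $R,S$ with $J_R=K$, $J_S=L$ and $T=R\bowtie S$. A subset $J\subseteq J_R$ is scindable for $R$ if $R_{|J}$ is scindable. The connective structure of $R$ is $\mathcal{K}_R=\{J\subseteq J_R : J \text{ is not scindable for } R\}$. A connective structure on a set $X$ is a set $\mathcal{K}$ of subsets of $X$ such that for every $\mathcal{I}\subseteq\mathcal{K}$,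 if $\bigcap_{K\in\mathcal{I}}K\neq\emptyset$ then $\bigcup_{K\in\mathcal{I}}K\in\mathcal{K}$ (in particular $\emptyset\in\mathcal{K}$); it is integral if $\{x\}\in\mathcal{K}$ for all $x\in X$. The axiom of choice is not assumed. *)

theory Defs
  imports "HOL-Library.FuncSet"
begin

text \<open>J-families are extensional maps (value undefined outside J): Z_J = PiE J E.
  A multiple relation is a pair (domain, graph).\<close>

type_synonym ('i, 'e) mrel = "'i set \<times> ('i \<Rightarrow> 'e) set"

definition Zfam :: "('i \<Rightarrow> 'e set) \<Rightarrow> 'i set \<Rightarrow> ('i \<Rightarrow> 'e) set" where
  "Zfam E J = PiE J E"

definition dom_rel :: "('i, 'e) mrel \<Rightarrow> 'i set" where
  "dom_rel R = fst R"

definition graph_rel :: "('i, 'e) mrel \<Rightarrow> ('i \<Rightarrow> 'e) set" where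
  "graph_rel R = snd R"

definition is_mrel :: "'i set \<Rightarrow> ('i \<Rightarrow> 'e set) \<Rightarrow> ('i, 'e) mrel \<Rightarrow> bool" where
  "is_mrel I E R \<longleftrightarrow> dom_rel R \<subseteq> I \<and> graph_rel R \<subseteq> Zfam E (dom_rel R)"

definition restr_rel :: "('i, 'e) mrel \<Rightarrow> 'i set \<Rightarrow> ('i, 'e) mrel" where
  "restr_rel R K = (K, (\<lambda>x. restrict x K) ` graph_rel R)"

definition prod_rel :: "('i \<Rightarrow> 'e set) \<Rightarrow> ('i, 'e) mrel \<Rightarrow> ('i, 'e) mrel \<Rightarrow> ('i, 'e) mrel" where
  "prod_rel E R S = (dom_rel R \<union> dom_rel S,
     {x \<in> Zfam E (dom_rel R \<union> dom_rel S).
        restrict x (dom_rel R) \<in> graph_rel R \<and> restrict x (dom_rel S) \<in> graph_rel S})"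

definition bipartition :: "'a set \<Rightarrow> 'a set \<Rightarrow> 'a set \<Rightarrow> bool" where
  "bipartition J K L \<longleftrightarrow> K \<noteq> {} \<and> L \<noteq> {} \<and> K \<inter> L = {} \<and> K \<union> L = J"

definition scindable :: "'i set \<Rightarrow> ('i \<Rightarrow> 'e set) \<Rightarrow> ('i, 'e) mrel \<Rightarrow> bool" where
  "scindable I E T \<longleftrightarrow> (\<exists>K L R S. bipartition (dom_rel T) K L \<and>
      is_mrel I E R \<and> is_mrel I E S \<and> dom_rel R = K \<and> dom_rel S = L \<and>
      T = prod_rel E R S)"

definition conn_struct_of :: "'i set \<Rightarrow> ('i \<Rightarrow> 'e set) \<Rightarrow> ('i, 'e) mrel \<Rightarrow> 'i set set" where
  "conn_struct_of I E R = {J. J \<subseteq> dom_rel R \<and> \<not> scindable I E (restr_rel R J)}"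

definition connective_structure :: "'a set \<Rightarrow> 'a set set \<Rightarrow> bool" where
  "connective_structure X \<K> \<longleftrightarrow> \<K> \<subseteq> Pow X \<and>
     (\<forall>\<I>. \<I> \<subseteq> \<K> \<longrightarrow> \<Inter>\<I> \<noteq> {} \<longrightarrow> \<Union>\<I> \<in> \<K>)"

definition integral_connective_structure :: "'a set \<Rightarrow> 'a set set \<Rightarrow> bool" where
  "integral_connective_structure X \<K> \<longleftrightarrow> connective_structure X \<K> \<and> (\<forall>x\<in>X. {x} \<in> \<K>)"

end

theory Submission
  imports Defs
begin

text \<open>Take every \<open>E i\<close> to be the set of all families of subsets of \<open>I\<close>, and read \<open>x i\<close> as the
  set of blocks that coordinate \<open>i\<close> votes for. The relation \<open>R\<close> on \<open>I\<close> consists of the families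
  in which no nonempty block \<open>C \<in> \<K>\<close> receives the unanimous vote of its members. Restricting \<open>R\<close>
  to \<open>J\<close> gives the same relation built on \<open>J\<close>. If \<open>J \<in> \<K>\<close>, two families in which \<open>J\<close> is rejected
  by different halves of a bipartition can be glued into one where \<open>J\<close> is unanimous, so \<open>J\<close> is not
  scindable. If \<open>J \<notin> \<K>\<close>, the component in \<open>J\<close> of a point splits \<open>J\<close> so that every block of \<open>\<K>\<close>
  inside \<open>J\<close> lies on one side, and the relation is the product of its two restrictions.\<close>

definition unanimity_free :: "'i set set \<Rightarrow> 'i set \<Rightarrow> ('i \<Rightarrow> 'i set set) set" where
  "unanimity_free \<K> J =
     {x \<in> PiE J (\<lambda>_. UNIV). \<forall>C\<in>\<K>. C \<noteq> {} \<longrightarrow> C \<subseteq> J \<longrightarrow> (\<exists>i\<in>C. C \<notin> x i)}"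

lemma restrict_in_unanimity_free_iff:
  "restrict x J \<in> unanimity_free \<K> J \<longleftrightarrow>
     (\<forall>C\<in>\<K>. C \<noteq> {} \<longrightarrow> C \<subseteq> J \<longrightarrow> (\<exists>i\<in>C. C \<notin> x i))"
  unfolding unanimity_free_def by (auto simp: subset_iff)

lemma image_restrict_unanimity_free:
  assumes "J \<subseteq> I"
  shows "(\<lambda>x. restrict x J) ` unanimity_free \<K> I = unanimity_free \<K> J"
proof
  show "(\<lambda>x. restrict x J) ` unanimity_free \<K> I \<subseteq> unanimity_free \<K> J"
  proof
    fix y assume "y \<in> (\<lambda>x. restrict x J) ` unanimity_free \<K> I"
    then obtain x where x: "x \<in> unanimity_free \<K> I" and y: "y = restrict x J" by blast
    have "\<forall>C\<in>\<K>. C \<noteq> {} \<longrightarrow> C \<subseteq> I \<longrightarrow> (\<exists>i\<in>C. C \<notin> x i)"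
      using x unfolding unanimity_free_def by blast
    then show "y \<in> unanimity_free \<K> J"
      unfolding y restrict_in_unanimity_free_iff using assms by (meson subset_trans)
  qed
next
  show "unanimity_free \<K> J \<subseteq> (\<lambda>x. restrict x J) ` unanimity_free \<K> I"
  proof
    fix y assume y: "y \<in> unanimity_free \<K> J"
    \<comment> \<open>extend by empty votes: blocks not inside \<open>J\<close> are rejected outside \<open>J\<close>\<close>
    define z where "z = restrict (\<lambda>i. if i \<in> J then y i else {}) I"
    have "z \<in> unanimity_free \<K> I"
      unfolding z_def restrict_in_unanimity_free_iff
    proof (intro ballI impI)
      fix C assume C: "C \<in> \<K>" "C \<noteq> {}" "C \<subseteq> I"
      show "\<exists>i\<in>C. C \<notin> (if i \<in> J then y i else {})"
      proof (cases "C \<subseteq> J")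
        case True
        then show ?thesis using y C unfolding unanimity_free_def by fastforce
      qed auto
    qed
    moreover have "restrict z J = y"
      using y assms by (auto simp: z_def unanimity_free_def PiE_def extensional_def fun_eq_iff)
    ultimately show "y \<in> (\<lambda>x. restrict x J) ` unanimity_free \<K> I" by force
  qed
qed

lemma restr_rel_unanimity_free:
  "J \<subseteq> I \<Longrightarrow> restr_rel (I, unanimity_free \<K> I) J = (J, unanimity_free \<K> J)"
  by (simp add: restr_rel_def graph_rel_def image_restrict_unanimity_free)

lemma scindable_imp_gluing:
  assumes "scindable I E (J, G)"
  obtains K L where "bipartition J K L"
    and "\<And>x y z. x \<in> G \<Longrightarrow> y \<in> G \<Longrightarrow> z \<in> PiE J E \<Longrightarrow>
           restrict z K = restrict x K \<Longrightarrow> restrict z L = restrict y L \<Longrightarrow> z \<in> G"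
proof -
  from assms obtain K L R S where bp: "bipartition J K L"
    and R: "dom_rel R = K" and S: "dom_rel S = L" and T: "(J, G) = prod_rel E R S"
    unfolding scindable_def dom_rel_def by auto
  have G: "G = {x \<in> PiE J E. restrict x K \<in> graph_rel R \<and> restrict x L \<in> graph_rel S}"
    using T R S bp unfolding prod_rel_def Zfam_def bipartition_def by auto
  show thesis
    by (rule that[OF bp]) (simp add: G)
qed

lemma vote_for_block_in_unanimity_free_iff:
  assumes "J \<in> \<K>" "J \<noteq> {}"
  shows "restrict (\<lambda>i. if i \<in> A then {J} else {}) J \<in> unanimity_free \<K> J \<longleftrightarrow> \<not> J \<subseteq> A"
  unfolding restrict_in_unanimity_free_iff using assms by auto

lemma unanimity_free_not_scindable:
  assumes "J \<in> \<K>"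
  shows "\<not> scindable I (\<lambda>_. UNIV) (J, unanimity_free \<K> J)"
proof
  assume "scindable I (\<lambda>_. UNIV) (J, unanimity_free \<K> J)"
  then obtain K L where bp: "bipartition J K L"
    and glue: "\<And>x y z. x \<in> unanimity_free \<K> J \<Longrightarrow> y \<in> unanimity_free \<K> J \<Longrightarrow>
                 z \<in> PiE J (\<lambda>_. UNIV) \<Longrightarrow> restrict z K = restrict x K \<Longrightarrow>
                 restrict z L = restrict y L \<Longrightarrow> z \<in> unanimity_free \<K> J"
    by (rule scindable_imp_gluing) blast
  define vote where "vote A = restrict (\<lambda>i. if i \<in> A then {J} else {}) J" for A
  have J: "J \<noteq> {}" "K \<union> L = J" "\<not> J \<subseteq> K" "\<not> J \<subseteq> L"
    using bp unfolding bipartition_def by blast+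
  have "vote J \<in> unanimity_free \<K> J"
  proof (rule glue)
    show "vote K \<in> unanimity_free \<K> J" "vote L \<in> unanimity_free \<K> J"
      using J assms by (simp_all add: vote_def vote_for_block_in_unanimity_free_iff)
    show "restrict (vote J) K = restrict (vote K) K" "restrict (vote J) L = restrict (vote L) L"
      using bp unfolding bipartition_def vote_def by (auto simp: fun_eq_iff)
  qed (simp add: vote_def)
  then show False
    using J assms by (simp add: vote_def vote_for_block_in_unanimity_free_iff)
qed

lemma integral_connective_structure_separating_bipartition:
  assumes ics: "integral_connective_structure I \<K>" and "J \<subseteq> I" and "J \<notin> \<K>"
  obtains K L where "bipartition J K L" and "\<And>C. C \<in> \<K> \<Longrightarrow> C \<subseteq> J \<Longrightarrow> C \<subseteq> K \<or> C \<subseteq> L"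
proof -
  have union: "\<And>\<I>. \<I> \<subseteq> \<K> \<Longrightarrow> \<Inter>\<I> \<noteq> {} \<Longrightarrow> \<Union>\<I> \<in> \<K>"
    using ics unfolding integral_connective_structure_def connective_structure_def by auto
  have "{} \<in> \<K>" using union[of "{}"] by simp
  with \<open>J \<notin> \<K>\<close> have "J \<noteq> {}" by auto
  then obtain a where a: "a \<in> J" by blast
  define K where "K = \<Union>{C \<in> \<K>. a \<in> C \<and> C \<subseteq> J}"
  have "{a} \<in> \<K>"
    using ics a \<open>J \<subseteq> I\<close> unfolding integral_connective_structure_def by auto
  then have aK: "a \<in> K" using a unfolding K_def by auto
  have KK: "K \<in> \<K>" unfolding K_def by (rule union) (use aK in auto)
  have KJ: "K \<subseteq> J" unfolding K_def by auto
  show thesis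
  proof (rule that)
    show "bipartition J K (J - K)"
      using aK KJ KK \<open>J \<notin> \<K>\<close> unfolding bipartition_def by auto
  next
    fix C assume C: "C \<in> \<K>" "C \<subseteq> J"
    show "C \<subseteq> K \<or> C \<subseteq> J - K"
    proof (cases "C \<inter> K = {}")
      case False
      then have "\<Union>{C, K} \<in> \<K>" using C KK by (intro union) auto
      then have "C \<union> K \<subseteq> K" using aK KJ C unfolding K_def by blast
      then show ?thesis by blast
    qed (use C in blast)
  qed
qed

lemma unanimity_free_prod_rel:
  assumes "bipartition J K L" and sep: "\<And>C. C \<in> \<K> \<Longrightarrow> C \<subseteq> J \<Longrightarrow> C \<subseteq> K \<or> C \<subseteq> L"
  shows "(J, unanimity_free \<K> J) = prod_rel (\<lambda>_. UNIV) (K, unanimity_free \<K> K) (L, unanimity_free \<K> L)"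
proof -
  have J: "K \<union> L = J" using assms(1) unfolding bipartition_def by blast
  have "(\<forall>C\<in>\<K>. C \<noteq> {} \<longrightarrow> C \<subseteq> J \<longrightarrow> P C) \<longleftrightarrow>
        (\<forall>C\<in>\<K>. C \<noteq> {} \<longrightarrow> C \<subseteq> K \<longrightarrow> P C) \<and> (\<forall>C\<in>\<K>. C \<noteq> {} \<longrightarrow> C \<subseteq> L \<longrightarrow> P C)"
    (is "?J \<longleftrightarrow> ?K \<and> ?L") for P
  proof
    show "?J \<Longrightarrow> ?K \<and> ?L" using J by blast
    assume KL: "?K \<and> ?L"
    show ?J
    proof (intro ballI impI)
      fix C assume C: "C \<in> \<K>" "C \<noteq> {}" "C \<subseteq> J"
      show "P C" using sep[OF C(1,3)] KL C(1,2) by blast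
    qed
  qed
  then have "unanimity_free \<K> J =
      {x \<in> PiE J (\<lambda>_. UNIV). restrict x K \<in> unanimity_free \<K> K \<and> restrict x L \<in> unanimity_free \<K> L}"
    unfolding restrict_in_unanimity_free_iff by (simp add: unanimity_free_def)
  then show ?thesis
    using J unfolding prod_rel_def dom_rel_def graph_rel_def Zfam_def by simp
qed

lemma unanimity_free_scindable:
  assumes "integral_connective_structure I \<K>" "J \<subseteq> I" "J \<notin> \<K>"
  shows "scindable I (\<lambda>_. UNIV) (J, unanimity_free \<K> J)"
proof -
  obtain K L where bp: "bipartition J K L"
    and sep: "\<And>C. C \<in> \<K> \<Longrightarrow> C \<subseteq> J \<Longrightarrow> C \<subseteq> K \<or> C \<subseteq> L"
    using integral_connective_structure_separating_bipartition[OF assms] by blast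
  have "is_mrel I (\<lambda>_. UNIV) (M, unanimity_free \<K> M)" if "M \<subseteq> J" for M
    using that \<open>J \<subseteq> I\<close> by (auto simp: is_mrel_def dom_rel_def graph_rel_def Zfam_def unanimity_free_def)
  moreover have "K \<subseteq> J" "L \<subseteq> J" using bp unfolding bipartition_def by auto
  moreover have "(J, unanimity_free \<K> J) =
      prod_rel (\<lambda>_. UNIV) (K, unanimity_free \<K> K) (L, unanimity_free \<K> L)"
    using bp sep by (rule unanimity_free_prod_rel)
  ultimately have "bipartition (dom_rel (J, unanimity_free \<K> J)) K L \<and>
      is_mrel I (\<lambda>_. UNIV) (K, unanimity_free \<K> K) \<and> is_mrel I (\<lambda>_. UNIV) (L, unanimity_free \<K> L) \<and>
      dom_rel (K, unanimity_free \<K> K) = K \<and> dom_rel (L, unanimity_free \<K> L) = L \<and>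
      (J, unanimity_free \<K> J) = prod_rel (\<lambda>_. UNIV) (K, unanimity_free \<K> K) (L, unanimity_free \<K> L)"
    using bp unfolding dom_rel_def fst_conv by blast
  then show ?thesis
    unfolding scindable_def by blast
qed

theorem mainTheorem1:
  fixes I :: "'i set"
  shows "\<exists>E :: 'i \<Rightarrow> 'i set set set.
           (\<forall>i\<in>I. E i \<noteq> {}) \<and>
           (\<forall>\<K>. integral_connective_structure I \<K> \<longrightarrow>
              (\<exists>R. is_mrel I E R \<and> conn_struct_of I E R = \<K>))"
proof (intro exI[of _ "\<lambda>_. UNIV"] conjI allI impI)
  fix \<K> :: "'i set set" assume ics: "integral_connective_structure I \<K>"
  let ?R = "(I, unanimity_free \<K> I)"
  have "\<K> \<subseteq> Pow I"
    using ics unfolding integral_connective_structure_def connective_structure_def by blast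
  have "J \<in> conn_struct_of I (\<lambda>_. UNIV) ?R \<longleftrightarrow> J \<in> \<K>" for J
  proof (cases "J \<subseteq> I")
    case True
    then show ?thesis
      using unanimity_free_not_scindable[of J \<K> I] unanimity_free_scindable[OF ics True]
      by (auto simp: conn_struct_of_def dom_rel_def restr_rel_unanimity_free)
  qed (use \<open>\<K> \<subseteq> Pow I\<close> in \<open>auto simp: conn_struct_of_def dom_rel_def\<close>)
  then have "conn_struct_of I (\<lambda>_. UNIV) ?R = \<K>" by blast
  moreover have "is_mrel I (\<lambda>_. UNIV) ?R"
    by (auto simp: is_mrel_def dom_rel_def graph_rel_def Zfam_def unanimity_free_def)
  ultimately show "\<exists>R. is_mrel I (\<lambda>_. UNIV :: 'i set set set) R \<and> conn_struct_of I (\<lambda>_. UNIV) R = \<K>"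
    by blast
qed simp

end
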